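(* Let $C_{CW}$ be a constant with the Carbery–Wright property described in the context, and let $\delta>0$ be such that $1/\delta$ is an integer. If $f:\mathbb{C}^n\to\mathbb{C}$ is a homogeneous polynomial of degree at most $r$ with $\|f\|_2=1$, then for every $\alpha>0$, $$\Pr_{v\text{ uniform on } G^{\mathbb{C}}_\delta}\Big[|f(v)|\le \alpha-\tfrac12\,\delta\cdot(16nr^2)^{2n+1}\Big]\le C_{CW}\cdot r\cdot(2\alpha)^{1/r}.$$
   Context: For a real polynomial $g$ on $\mathbb{R}^m$, $\|g\|_2=(\mathbb{E}_x[g(x)^2])^{1/2}$ with $x$ uniform on $[-1,1]^m$. For $f\in\mathbb{C}[x_1,\dots,x_n]$ write $f(a+\iota b)=\Re(f)(a,b)+\iota\,\Im(f)(a,b)$ ($a,b\in\mathbb{R}^n$), with $\Re(f),\Im(f)$ real polynomials in $2n$ variables, and set $\|f\|_2=\|\Re(f)\|_2+\|\Im(f)\|_2$. Carbery–Wright property: for all positive integers $n,r$, every real polynomial $g:\mathbb{R}^n\to\mathbb{R}$ of degree at most $r$ with $\|g\|_2=1$, and every $\alpha>0$, $\Pr_{v\text{ uniform on }[-1,1)^n}[|g(v)|\le\alpha]\le C_{CW}\,r\,\alpha^{1/r}$. $G_\delta=\{-1,-1+\delta,\dots,1-2\delta,1-\delta\}^n$ and $G^{\mathbb{C}}_\delta=\{a+\iota b: a,b\in G_\delta\}$, $\iota=\sqrt{-1}$. *)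

theory Defs
  imports "HOL-Probability.Probability" "HOL-Library.Poly_Mapping"
begin

text \<open>
  Since the Carbery--Wright hypothesis quantifies over the dimension, points of the
  \<open>n\<close>-dimensional space are extensional functions on \<open>{..<n}\<close>.  A multivariate
  polynomial is a finitely supported map from exponent vectors to coefficients.
\<close>

type_synonym 'a mpolynomial = "(nat \<Rightarrow>\<^sub>0 nat) \<Rightarrow>\<^sub>0 'a"

definition monom_degree :: "(nat \<Rightarrow>\<^sub>0 nat) \<Rightarrow> nat" where
  "monom_degree m = (\<Sum>i\<in>Poly_Mapping.keys m. Poly_Mapping.lookup m i)"

definition polynomial_in :: "nat \<Rightarrow> 'a::zero mpolynomial \<Rightarrow> bool" where
  "polynomial_in n p \<longleftrightarrow> (\<forall>m\<in>Poly_Mapping.keys p. Poly_Mapping.keys m \<subseteq> {..<n})"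

definition total_degree :: "'a::zero mpolynomial \<Rightarrow> nat" where
  "total_degree p = Max (insert 0 (monom_degree ` Poly_Mapping.keys p))"

definition homogeneous :: "'a::zero mpolynomial \<Rightarrow> bool" where
  "homogeneous p \<longleftrightarrow> (\<exists>d. \<forall>m\<in>Poly_Mapping.keys p. monom_degree m = d)"

definition poly_eval :: "'a::comm_semiring_1 mpolynomial \<Rightarrow> (nat \<Rightarrow> 'a) \<Rightarrow> 'a" where
  "poly_eval p x = (\<Sum>m\<in>Poly_Mapping.keys p. Poly_Mapping.lookup p m * (\<Prod>i\<in>Poly_Mapping.keys m. x i ^ Poly_Mapping.lookup m i))"

definition uniform_on_cube :: "nat \<Rightarrow> real set \<Rightarrow> (nat \<Rightarrow> real) measure" where
  "uniform_on_cube n I =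
     uniform_measure (\<Pi>\<^sub>M i\<in>{..<n}. lborel) (\<Pi>\<^sub>E i\<in>{..<n}. I)"

definition l2_norm :: "nat \<Rightarrow> ((nat \<Rightarrow> real) \<Rightarrow> real) \<Rightarrow> real" where
  "l2_norm m g = sqrt (\<integral>x. (g x)\<^sup>2 \<partial>uniform_on_cube m {-1..1})"

definition complex_point :: "nat \<Rightarrow> (nat \<Rightarrow> real) \<Rightarrow> (nat \<Rightarrow> real) \<Rightarrow> nat \<Rightarrow> complex" where
  "complex_point n a b = (\<lambda>i\<in>{..<n}. complex_of_real (a i) + \<i> * complex_of_real (b i))"

text \<open>
  The real and imaginary parts are functions of \<open>2 * n\<close> real variables: the first \<open>n\<close>
  coordinates hold \<open>a\<close> and the last \<open>n\<close> hold \<open>b\<close>.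
\<close>

definition Re_poly :: "nat \<Rightarrow> complex mpolynomial \<Rightarrow> (nat \<Rightarrow> real) \<Rightarrow> real" where
  "Re_poly n f x = Re (poly_eval f (complex_point n x (\<lambda>i. x (n + i))))"

definition Im_poly :: "nat \<Rightarrow> complex mpolynomial \<Rightarrow> (nat \<Rightarrow> real) \<Rightarrow> real" where
  "Im_poly n f x = Im (poly_eval f (complex_point n x (\<lambda>i. x (n + i))))"

definition complex_l2_norm :: "nat \<Rightarrow> complex mpolynomial \<Rightarrow> real" where
  "complex_l2_norm n f = l2_norm (2 * n) (Re_poly n f) + l2_norm (2 * n) (Im_poly n f)"

definition carbery_wright :: "real \<Rightarrow> bool" where
  "carbery_wright C \<longleftrightarrow>
     (\<forall>(n::nat) (r::nat) (g :: real mpolynomial) (\<alpha>::real).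
        0 < n \<longrightarrow> 0 < r \<longrightarrow> polynomial_in n g \<longrightarrow> total_degree g \<le> r \<longrightarrow>
        l2_norm n (poly_eval g) = 1 \<longrightarrow> 0 < \<alpha> \<longrightarrow>
        \<P>(v in uniform_on_cube n {-1..<1}. \<bar>poly_eval g v\<bar> \<le> \<alpha>)
          \<le> C * real r * \<alpha> powr (1 / real r))"

definition real_grid :: "nat \<Rightarrow> real \<Rightarrow> (nat \<Rightarrow> real) set" where
  "real_grid n \<delta> =
     (\<Pi>\<^sub>E i\<in>{..<n}. {-1 + real j * \<delta> | j :: nat. -1 + real j * \<delta> \<le> 1 - \<delta>})"

definition complex_grid :: "nat \<Rightarrow> real \<Rightarrow> (nat \<Rightarrow> complex) set" where
  "complex_grid n \<delta> =
     {complex_point n a b | a b. a \<in> real_grid n \<delta> \<and> b \<in> real_grid n \<delta>}"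

end

theory Submission
  imports Defs
begin

text \<open>
  One of the real and imaginary parts of \<open>f\<close>, say \<open>g\<close>, has \<open>L\<^sup>2\<close> norm between 1/2 and 1, and
  Carbery--Wright applied to \<open>g\<close> divided by its norm bounds the probability that \<open>\<bar>g\<bar> \<le> \<alpha>\<close> on the
  cube of dimension \<open>2 n\<close>.  The grid points are the corners of disjoint cells of side \<open>\<delta>\<close> that tile
  this cube, so it suffices that \<open>g\<close> varies by at most \<open>\<delta> (16 n r\<^sup>2)\<^bsup>2n+1\<^esup> / 2\<close> on each cell.

  The variation is controlled one coordinate at a time.  A univariate polynomial of degree at most
  \<open>r\<close> is expanded in Chebyshev polynomials of the second kind \<open>U\<^sub>k\<close>.  Since
  \<open>U\<^sub>k (cos t) sin t = sin ((k + 1) t)\<close>, Parseval for sines bounds the sum of the squared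
  coefficients by the \<open>L\<^sup>2\<close> norm, and the elementary bounds \<open>\<bar>U\<^sub>k\<bar> \<le> k + 1\<close> and
  \<open>Lip U\<^sub>k \<le> (k + 1) k\<^sup>2\<close> turn this into bounds on the supremum and the Lipschitz constant.
  Fubini carries both over to several variables.
\<close>

section \<open>Univariate polynomials: sup and Lipschitz bounds from the mean square\<close>

fun chebyshev_U :: "nat \<Rightarrow> real \<Rightarrow> real" where
  "chebyshev_U 0 x = 1"
| "chebyshev_U (Suc 0) x = 2 * x"
| "chebyshev_U (Suc (Suc k)) x = 2 * x * chebyshev_U (Suc k) x - chebyshev_U k x"

lemma cos_three_term: "cos (real (Suc (Suc k)) * t) = 2 * cos t * cos (real (Suc k) * t) - cos (real k * t)"
proof -
  have "cos (real (Suc (Suc k)) * t) = cos (real (Suc k) * t + t)" 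
    and "cos (real k * t) = cos (real (Suc k) * t - t)"
    by (simp_all add: algebra_simps)
  then show ?thesis by (simp add: cos_add cos_diff)
qed

lemma sin_three_term: "sin (real (Suc (Suc k)) * t) = 2 * cos t * sin (real (Suc k) * t) - sin (real k * t)"
proof -
  have "sin (real (Suc (Suc k)) * t) = sin (real (Suc k) * t + t)" 
    and "sin (real k * t) = sin (real (Suc k) * t - t)"
    by (simp_all add: algebra_simps)
  then show ?thesis by (simp add: sin_add sin_diff)
qed

lemma chebyshev_U_sin: "chebyshev_U k (cos t) * sin t = sin (real (Suc k) * t)"
proof (induction k rule: induct_nat_012)
  case 1
  then show ?case using sin_three_term[of 0 t] by simp
next
  case (ge2 k)
  show ?case using ge2 sin_three_term[of "Suc k" t] by (simp add: left_diff_distrib mult.assoc)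
qed simp

text \<open>The classical identity U_{k+2} - U_k = 2 T_{k+2}: cosines and the U_k obey the same
  three-term recurrence, so two base cases suffice. It reduces the sup and Lipschitz bounds on U_k
  to bounds on cosines by induction in steps of two.\<close>

lemma chebyshev_U_step:
  "chebyshev_U (Suc (Suc k)) (cos t) = chebyshev_U k (cos t) + 2 * cos (real (Suc (Suc k)) * t)"
proof (induction k rule: induct_nat_012)
  case 0
  then show ?case using cos_three_term[of 0 t] by simp
next
  case 1
  have "cos (2 * t) = 2 * cos t * cos t - 1" "cos (3 * t) = 2 * cos t * cos (2 * t) - cos t"
    using cos_three_term[of 0 t] cos_three_term[of 1 t] by simp_all
  then have "cos (3 * t) = 2 * cos t * (2 * cos t * cos t - 1) - cos t" by simp
  then show ?case by (simp add: algebra_simps)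
next
  case (ge2 k)
  let ?c = "cos t" and ?a = "\<lambda>j. cos (real j * t)"
  have "chebyshev_U (Suc (Suc (Suc (Suc k)))) ?c
      = 2 * ?c * chebyshev_U (Suc (Suc (Suc k))) ?c - chebyshev_U (Suc (Suc k)) ?c"
    by (rule chebyshev_U.simps)
  also have "\<dots> = 2 * ?c * (chebyshev_U (Suc k) ?c + 2 * ?a (Suc (Suc (Suc k))))
      - (chebyshev_U k ?c + 2 * ?a (Suc (Suc k)))"
    by (simp only: ge2)
  also have "\<dots> = (2 * ?c * chebyshev_U (Suc k) ?c - chebyshev_U k ?c)
      + 2 * (2 * ?c * ?a (Suc (Suc (Suc k))) - ?a (Suc (Suc k)))"
    by (simp add: algebra_simps del: of_nat_Suc)
  also have "\<dots> = chebyshev_U (Suc (Suc k)) ?c + 2 * ?a (Suc (Suc (Suc (Suc k))))"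
    by (simp only: cos_three_term[of "Suc (Suc k)"] chebyshev_U.simps)
  finally show ?case .
qed

lemma chebyshev_U_bound:
  assumes "\<bar>x\<bar> \<le> 1"
  shows "\<bar>chebyshev_U k x\<bar> \<le> real (Suc k)"
proof -
  have x: "x = cos (arccos x)" using assms by simp
  show ?thesis
  proof (induction k rule: induct_nat_012)
    case 1
    then show ?case using assms by simp
  next
    case (ge2 k)
    have "chebyshev_U (Suc (Suc k)) x = chebyshev_U k x + 2 * cos (real (Suc (Suc k)) * arccos x)"
      using chebyshev_U_step[of k "arccos x"] x by simp
    moreover have "\<bar>cos (real (Suc (Suc k)) * arccos x)\<bar> \<le> 1" by (rule abs_cos_le_one)
    ultimately show ?case using ge2 by linarith
  qed simp
qed

lemma abs_sin_mult_le: "\<bar>sin (real k * t)\<bar> \<le> real k * \<bar>sin t\<bar>"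
proof (induction k)
  case (Suc k)
  have "sin (real (Suc k) * t) = sin (real k * t) * cos t + cos (real k * t) * sin t"
    by (simp add: algebra_simps sin_add)
  also have "\<bar>\<dots>\<bar> \<le> \<bar>sin (real k * t)\<bar> * \<bar>cos t\<bar> + \<bar>cos (real k * t)\<bar> * \<bar>sin t\<bar>"
    by (metis abs_mult abs_triangle_ineq)
  also have "\<dots> \<le> \<bar>sin (real k * t)\<bar> * 1 + 1 * \<bar>sin t\<bar>"
    by (intro add_mono mult_mono) auto
  finally show ?case using Suc by (simp add: algebra_simps)
qed simp

text \<open>Read in the variable x = cos t, this says that T_k has Lipschitz constant k^2 on
  [-1, 1]. The product formula for a difference of cosines gives it without derivatives, each of the
  two sines contributing one factor k.\<close>

lemma cos_mult_diff_le:
  "\<bar>cos (real k * s) - cos (real k * t)\<bar> \<le> (real k)\<^sup>2 * \<bar>cos s - cos t\<bar>"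
proof -
  have "\<bar>cos (real k * s) - cos (real k * t)\<bar> =
      2 * (\<bar>sin (real k * ((s + t) / 2))\<bar> * \<bar>sin (real k * ((t - s) / 2))\<bar>)"
    by (simp add: cos_diff_cos abs_mult algebra_simps add_divide_distrib diff_divide_distrib)
  also have "\<dots> \<le> 2 * ((real k * \<bar>sin ((s + t) / 2)\<bar>) * (real k * \<bar>sin ((t - s) / 2)\<bar>))"
    by (intro mult_left_mono mult_mono abs_sin_mult_le) auto
  also have "\<dots> = (real k)\<^sup>2 * \<bar>cos s - cos t\<bar>"
    by (simp add: cos_diff_cos abs_mult power2_eq_square algebra_simps)
  finally show ?thesis .
qed

lemma chebyshev_U_lipschitz:
  assumes "\<bar>x\<bar> \<le> 1" "\<bar>y\<bar> \<le> 1"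
  shows "\<bar>chebyshev_U k x - chebyshev_U k y\<bar> \<le> real (Suc k) * (real k)\<^sup>2 * \<bar>x - y\<bar>"
proof (induction k rule: induct_nat_012)
  case 1
  have "chebyshev_U (Suc 0) x - chebyshev_U (Suc 0) y = 2 * (x - y)" by simp
  then show ?case by (simp only: abs_mult) simp
next
  case (ge2 k)
  let ?K = "real (Suc (Suc k))"
  have "chebyshev_U (Suc (Suc k)) z = chebyshev_U k z + 2 * cos (?K * arccos z)" if "\<bar>z\<bar> \<le> 1" for z
    using chebyshev_U_step[of k "arccos z"] that by simp
  from this[OF assms(1)] this[OF assms(2)]
  have "chebyshev_U (Suc (Suc k)) x - chebyshev_U (Suc (Suc k)) y
      = (chebyshev_U k x - chebyshev_U k y) + 2 * (cos (?K * arccos x) - cos (?K * arccos y))"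
    by algebra
  then have "\<bar>chebyshev_U (Suc (Suc k)) x - chebyshev_U (Suc (Suc k)) y\<bar>
      \<le> \<bar>chebyshev_U k x - chebyshev_U k y\<bar> + 2 * \<bar>cos (?K * arccos x) - cos (?K * arccos y)\<bar>"
    by (metis abs_triangle_ineq abs_mult abs_numeral)
  also have "\<dots> \<le> real (Suc k) * (real k)\<^sup>2 * \<bar>x - y\<bar> + 2 * (?K\<^sup>2 * \<bar>x - y\<bar>)"
    using ge2(1) cos_mult_diff_le[of "Suc (Suc k)" "arccos x" "arccos y"] assms
    by (intro add_mono mult_left_mono) auto
  also have "\<dots> = (real (Suc k) * (real k)\<^sup>2 + 2 * ?K\<^sup>2) * \<bar>x - y\<bar>"
    by (simp add: algebra_simps)
  \<comment> \<open>Of the k + 3 copies of (k + 2)^2, two pay for the cosine term and the other k +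
    1 dominate the (k + 1) k^2 from the induction hypothesis.\<close>
  also have "\<dots> \<le> (real (Suc (Suc (Suc k))) * ?K\<^sup>2) * \<bar>x - y\<bar>"
    by (intro mult_right_mono) (auto simp: power2_eq_square algebra_simps)
  finally show ?case by simp
qed simp

text \<open>Induction on the degree through P = a + x Q: since x U_k = (U_{k+1} + U_{k-1}) / 2,
  multiplying by x only shifts and averages coefficients.\<close>

lemma poly_chebyshev_expansion:
  assumes "degree P \<le> r"
  shows "\<exists>b. \<forall>x. poly P x = (\<Sum>k\<le>r. b k * chebyshev_U k x)"
  using assms
proof (induction r arbitrary: P)
  case 0
  then obtain c where "P = [:c:]" using degree_eq_zeroE by blast
  then show ?case by (intro exI[of _ "\<lambda>_. c"]) simp
next
  case (Suc r)
  obtain a Q where P: "P = pCons a Q" by (cases P)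
  have "degree Q \<le> r" using Suc.prems unfolding P by (auto split: if_splits)
  then obtain b where b: "\<And>x. poly Q x = (\<Sum>k\<le>r. b k * chebyshev_U k x)"
    using Suc.IH by blast
  \<comment> \<open>Padding by zero makes the shifted coefficient \<open>\<beta> (Suc k)\<close>
    meaningful at the top indices. The constant a goes to index 0 of \<open>c\<close>, because U_0 =
    1.\<close>
  define \<beta> where "\<beta> k = (if k \<le> r then b k else 0)" for k
  define c where "c k = (if k = 0 then a + \<beta> 1 / 2 else (\<beta> (k - 1) + \<beta> (Suc k)) / 2)" for k
  \<comment> \<open>The downward shift should stop at index r - 1; running it to r adds one surplus
    term, which is subtracted again. It vanishes for the padded \<open>\<beta>\<close>.\<close>
  have x0: "(\<Sum>k\<le>r. \<beta> k * (x * chebyshev_U k x)) = 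
     (\<Sum>k\<le>Suc r. (if k = 0 then 0 else \<beta> (k-1)) / 2 * chebyshev_U k x) + (\<Sum>k\<le>r. \<beta> (Suc k) / 2 * chebyshev_U k x) 
       - \<beta> (Suc r) / 2 * chebyshev_U r x" for x and \<beta> :: "nat \<Rightarrow> real" and r
  proof (induction r)
    case (Suc r)
    have *: "x * chebyshev_U (Suc r) x = (chebyshev_U (Suc (Suc r)) x + chebyshev_U r x) / 2"
      by simp
    show ?case unfolding sum.atMost_Suc[of _ r] sum.atMost_Suc[of _ "Suc r"] Suc *
      by (simp add: algebra_simps add_divide_distrib diff_divide_distrib del: chebyshev_U.simps)
  qed simp
  have "poly P x = (\<Sum>k\<le>Suc r. c k * chebyshev_U k x)" for x
  proof -
    have "poly P x = a + (\<Sum>k\<le>r. \<beta> k * (x * chebyshev_U k x))"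
      by (simp add: P b sum_distrib_left mult.left_commute \<beta>_def)
    also have "\<dots> = a + (\<Sum>k\<le>Suc r. (if k = 0 then 0 else \<beta> (k-1)) / 2 * chebyshev_U k x)
        + (\<Sum>k\<le>Suc r. \<beta> (Suc k) / 2 * chebyshev_U k x)"
      unfolding x0 by (simp add: \<beta>_def)
    also have "a = (\<Sum>k\<le>Suc r. (if k = 0 then a else 0) * chebyshev_U k x)"
      by (subst sum.atMost_Suc_shift) simp
    finally have "poly P x = (\<Sum>k\<le>Suc r. (if k = 0 then a else 0) * chebyshev_U k x + (if k = 0 then 0 else \<beta> (k-1)) / 2 * chebyshev_U k x
       + \<beta> (Suc k) / 2 * chebyshev_U k x)"
      by (simp only: sum.distrib)
    also have "\<dots> = (\<Sum>k\<le>Suc r. c k * chebyshev_U k x)"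
      by (intro sum.cong refl) (auto simp: c_def algebra_simps add_divide_distrib)
    finally show ?thesis .
  qed
  then show ?case by blast
qed

section \<open>Parseval for sines and the univariate mean-square bounds\<close>

lemma has_integral_sin_sin:
  "((\<lambda>t. sin (real (Suc j) * t) * sin (real (Suc k) * t)) has_integral (if j = k then pi / 2 else 0)) {0..pi}"
proof (cases "j = k")
  case True
  define K where "K = real (Suc k)"
  have K: "K \<noteq> 0" unfolding K_def by simp
  define F where "F t = t / 2 - sin (2 * K * t) / (4 * K)" for t
  have "((\<lambda>t. sin (real (Suc j) * t) * sin (real (Suc k) * t)) has_integral (F pi - F 0)) {0..pi}"
  proof (rule fundamental_theorem_of_calculus)
    fix t assume "t \<in> {0..pi}"
    have eq: "sin (K * t) * sin (K * t) = (1 - cos (2 * K * t)) / 2"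
      using cos_double_sin[of "K * t"] by (simp add: power2_eq_square mult.assoc)
    show "(F has_vector_derivative sin (real (Suc j) * t) * sin (real (Suc k) * t)) (at t within {0..pi})"
      unfolding F_def has_real_derivative_iff_has_vector_derivative[symmetric] True K_def[symmetric]
      unfolding eq using K by (auto intro!: derivative_eq_intros simp: field_simps)
  qed simp
  moreover have "F pi - F 0 = pi / 2"
    using sin_npi[of "2 * Suc k"] by (simp add: F_def K_def)
  ultimately show ?thesis using True by simp
next
  case False
  define m where "m = real (Suc j) - real (Suc k)"
  define p where "p = real (Suc j) + real (Suc k)"
  have m: "m \<noteq> 0" using False by (simp add: m_def)
  have p: "p \<noteq> 0" unfolding p_def by simp
  define F where "F t = sin (m * t) / (2 * m) - sin (p * t) / (2 * p)" for t
  have "((\<lambda>t. sin (real (Suc j) * t) * sin (real (Suc k) * t)) has_integral (F pi - F 0)) {0..pi}"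
  proof (rule fundamental_theorem_of_calculus)
    fix t assume "t \<in> {0..pi}"
    have eq: "sin (real (Suc j) * t) * sin (real (Suc k) * t) = (cos (m * t) - cos (p * t)) / 2"
      unfolding sin_times_sin m_def p_def by (simp add: algebra_simps)
    show "(F has_vector_derivative sin (real (Suc j) * t) * sin (real (Suc k) * t)) (at t within {0..pi})"
      unfolding F_def has_real_derivative_iff_has_vector_derivative[symmetric] eq
      using m p by (auto intro!: derivative_eq_intros simp: field_simps simp del: of_nat_Suc)
  qed simp
  moreover have "F pi - F 0 = 0"
  proof -
    have "m \<in> \<int>" "p \<in> \<int>" unfolding m_def p_def by auto
    then have "sin (m * pi) = 0" "sin (p * pi) = 0"
      by (metis sin_integer_2pi sin_times_pi_eq_0)+
    then show ?thesis by (simp add: F_def)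
  qed
  ultimately show ?thesis using False by simp
qed

lemma poly_antiderivative:
  fixes P :: "real poly"
  shows "\<exists>F. \<forall>x. (F has_real_derivative poly P x) (at x)"
proof (intro exI allI)
  fix x
  show "((\<lambda>x. \<Sum>i\<le>degree P. coeff P i * x ^ Suc i / real (Suc i)) has_real_derivative poly P x) (at x)"
    unfolding poly_altdef
    by (auto intro!: derivative_eq_intros sum.cong simp: field_simps simp del: of_nat_Suc power_Suc)
qed

abbreviation unif_interval :: "real measure" where
  "unif_interval \<equiv> uniform_measure lborel {-1..1}"

lemma borel_measurable_poly [measurable]: "poly (P :: real poly) \<in> borel_measurable borel"
  by (intro borel_measurable_continuous_onI continuous_intros)

text \<open>With x = cos t, the integral of P^2 over [-1, 1] becomes that of P(cos t)^2 sin t over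
  [0, pi]. Because sin^2 is at most sin there, it dominates the integral of (P(cos t) sin t)^2, and
  P(cos t) sin t is the sine series with coefficients b_k. Parseval gives pi/2 times the sum of
  squares, and pi/2 is at least 1. The factor 2 undoes the normalisation of
  \<open>unif_interval\<close>.\<close>

lemma chebyshev_coeff_sum_le:
  assumes "\<And>x. poly P x = (\<Sum>k\<le>r. b k * chebyshev_U k x)"
  shows "ennreal (\<Sum>k\<le>r. (b k)\<^sup>2) \<le> 2 * (\<integral>\<^sup>+x. ennreal ((poly P x)\<^sup>2) \<partial>unif_interval)"
proof -
  obtain F where "\<forall>x. (F has_real_derivative poly (P ^ 2) x) (at x)"
    using poly_antiderivative by blast
  then have F: "(F has_real_derivative (poly P x)\<^sup>2) (at x)" for x by simp
  have eq: "(\<integral>\<^sup>+x. ennreal ((poly P x)\<^sup>2) * indicator {-1..1} x \<partial>lborel) = ennreal (F 1 - F (-1))"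
    by (rule nn_integral_FTC_Icc) (auto intro: F[THEN has_field_derivative_at_within])
  \<comment> \<open>The substitution x = cos t is carried out by differentiating - F(cos t), where F
    is an antiderivative of P^2.\<close>
  have 1: "((\<lambda>t. (poly P (cos t))\<^sup>2 * sin t) has_integral (- F (cos pi) - (- F (cos 0)))) {0..pi}"
  proof (rule fundamental_theorem_of_calculus)
    fix t
    show "((\<lambda>t. - F (cos t)) has_vector_derivative (poly P (cos t))\<^sup>2 * sin t) (at t within {0..pi})"
      unfolding has_real_derivative_iff_has_vector_derivative[symmetric]
      by (rule derivative_eq_intros DERIV_chain2[OF F] refl | simp)+
  qed simp
  have 2: "((\<lambda>t. (poly P (cos t) * sin t)\<^sup>2) has_integral (pi / 2 * (\<Sum>k\<le>r. (b k)\<^sup>2))) {0..pi}"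
  proof -
    have "(poly P (cos t) * sin t)\<^sup>2 = (\<Sum>j\<le>r. \<Sum>k\<le>r. b j * b k * (sin (real (Suc j) * t) * sin (real (Suc k) * t)))" for t
    proof -
      have "poly P (cos t) * sin t = (\<Sum>k\<le>r. b k * sin (real (Suc k) * t))"
        unfolding assms sum_distrib_right mult.assoc chebyshev_U_sin ..
      then show ?thesis
        unfolding power2_eq_square by (simp only: sum_product mult_ac)
    qed
    moreover have "((\<lambda>t. \<Sum>j\<le>r. \<Sum>k\<le>r. b j * b k * (sin (real (Suc j) * t) * sin (real (Suc k) * t))) has_integral
       (\<Sum>j\<le>r. \<Sum>k\<le>r. b j * b k * (if j = k then pi / 2 else 0))) {0..pi}"
      by (intro has_integral_sum has_integral_mult_right has_integral_sin_sin) auto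
    moreover have "(\<Sum>j\<le>r. \<Sum>k\<le>r. b j * b k * (if j = k then pi / 2 else 0)) = pi / 2 * (\<Sum>k\<le>r. (b k)\<^sup>2)"
      by (simp add: sum_distrib_left power2_eq_square if_distrib mult.commute cong: if_cong)
    ultimately show ?thesis by simp
  qed
  have "pi / 2 * (\<Sum>k\<le>r. (b k)\<^sup>2) \<le> - F (cos pi) - (- F (cos 0))"
  proof (rule has_integral_le[OF 2 1])
    fix t assume "t \<in> {0..pi}"
    then have "0 \<le> sin t" by (simp add: sin_ge_zero)
    then have "sin t * sin t \<le> sin t * 1" by (intro mult_left_mono) auto
    then show "(poly P (cos t) * sin t)\<^sup>2 \<le> (poly P (cos t))\<^sup>2 * sin t"
      by (simp add: power_mult_distrib power2_eq_square[of "sin t"] mult_left_mono)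
  qed
  moreover have "1 * (\<Sum>k\<le>r. (b k)\<^sup>2) \<le> pi / 2 * (\<Sum>k\<le>r. (b k)\<^sup>2)"
    using pi_ge_two by (intro mult_right_mono sum_nonneg) auto
  ultimately have "(\<Sum>k\<le>r. (b k)\<^sup>2) \<le> F 1 - F (-1)" by simp
  also have "ennreal (F 1 - F (-1)) = 2 * (ennreal (F 1 - F (-1)) / 2)"
    by (simp add: ennreal_times_divide mult.commute[of 2] mult_divide_eq_ennreal)
  also have "\<dots> = 2 * (\<integral>\<^sup>+x. ennreal ((poly P x)\<^sup>2) \<partial>unif_interval)"
    by (subst nn_integral_uniform_measure) (auto simp: eq)
  finally show ?thesis using ennreal_leI by blast
qed

text \<open>Cauchy-Schwarz for a linear functional with value \<open>v\<close> at P and values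
  \<open>w k\<close> at U_k. It serves twice: for evaluation at a point, and for the difference of
  two evaluations.\<close>

lemma chebyshev_functional_bound:
  assumes "degree P \<le> r" and "\<And>k. k \<le> r \<Longrightarrow> \<bar>w k\<bar> \<le> W"
    and "\<And>b. (\<And>x. poly P x = (\<Sum>k\<le>r. b k * chebyshev_U k x)) \<Longrightarrow> v = (\<Sum>k\<le>r. b k * w k)"
  shows "ennreal (v\<^sup>2) \<le> ennreal (2 * real (Suc r) * W\<^sup>2) * (\<integral>\<^sup>+x. ennreal ((poly P x)\<^sup>2) \<partial>unif_interval)"
proof -
  obtain b where b: "\<And>x. poly P x = (\<Sum>k\<le>r. b k * chebyshev_U k x)"
    using poly_chebyshev_expansion[OF assms(1)] by blast
  have "v\<^sup>2 \<le> (\<Sum>k\<le>r. (b k)\<^sup>2) * (\<Sum>k\<le>r. (w k)\<^sup>2)"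
    unfolding assms(3)[OF b] by (rule Cauchy_Schwarz_ineq_sum)
  also have "\<dots> \<le> (\<Sum>k\<le>r. (b k)\<^sup>2) * (\<Sum>k\<le>r. W\<^sup>2)"
    by (intro mult_left_mono sum_mono sum_nonneg) (use assms(2) in \<open>auto simp: abs_le_square_iff[symmetric] intro: order_trans[OF _ abs_ge_self]\<close>)
  also have "\<dots> = real (Suc r) * W\<^sup>2 * (\<Sum>k\<le>r. (b k)\<^sup>2)" by simp
  finally have "ennreal (v\<^sup>2) \<le> ennreal (real (Suc r) * W\<^sup>2) * ennreal (\<Sum>k\<le>r. (b k)\<^sup>2)"
    by (simp add: ennreal_leI ennreal_mult'[symmetric] sum_nonneg)
  also have "\<dots> \<le> ennreal (real (Suc r) * W\<^sup>2) * (2 * (\<integral>\<^sup>+x. ennreal ((poly P x)\<^sup>2) \<partial>unif_interval))"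
    by (intro mult_left_mono chebyshev_coeff_sum_le b) auto
  also have "\<dots> = ennreal (2 * real (Suc r) * W\<^sup>2) * (\<integral>\<^sup>+x. ennreal ((poly P x)\<^sup>2) \<partial>unif_interval)"
    by (simp add: ennreal_mult' mult_ac del: of_nat_Suc)
  finally show ?thesis .
qed

lemma poly_sup_le_L2:
  assumes "degree P \<le> r" "\<bar>x\<bar> \<le> 1"
  shows "ennreal ((poly P x)\<^sup>2) \<le> ennreal (2 * real (Suc r) ^ 3) * (\<integral>\<^sup>+x. ennreal ((poly P x)\<^sup>2) \<partial>unif_interval)"
proof -
  have "\<bar>chebyshev_U k x\<bar> \<le> real (Suc r)" if "k \<le> r" for k
    using chebyshev_U_bound[OF assms(2), of k] that by simp
  from chebyshev_functional_bound[OF assms(1) this, where v = "poly P x"]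
  show ?thesis by (simp add: power3_eq_cube power2_eq_square mult.assoc del: of_nat_Suc)
qed

lemma poly_lipschitz_le_L2:
  assumes "degree P \<le> r" "\<bar>x\<bar> \<le> 1" "\<bar>y\<bar> \<le> 1"
  shows "ennreal ((poly P x - poly P y)\<^sup>2) \<le> ennreal (2 * real (Suc r) ^ 3 * real r ^ 4 * (x - y)\<^sup>2)
    * (\<integral>\<^sup>+x. ennreal ((poly P x)\<^sup>2) \<partial>unif_interval)"
proof -
  have "\<bar>chebyshev_U k x - chebyshev_U k y\<bar> \<le> real (Suc r) * (real r)\<^sup>2 * \<bar>x - y\<bar>" if "k \<le> r" for k
    using chebyshev_U_lipschitz[OF assms(2,3), of k] that
    by (elim order_trans) (intro mult_mono power_mono, auto)
  from chebyshev_functional_bound[OF assms(1) this, where v = "poly P x - poly P y"]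
  have "ennreal ((poly P x - poly P y)\<^sup>2) \<le> ennreal (2 * real (Suc r) * (real (Suc r) * (real r)\<^sup>2 * \<bar>x - y\<bar>)\<^sup>2)
    * (\<integral>\<^sup>+x. ennreal ((poly P x)\<^sup>2) \<partial>unif_interval)"
    by (simp add: right_diff_distrib sum_subtractf del: of_nat_Suc)
  also have "2 * real (Suc r) * (real (Suc r) * (real r)\<^sup>2 * \<bar>x - y\<bar>)\<^sup>2 = 2 * real (Suc r) ^ 3 * real r ^ 4 * (x - y)\<^sup>2"
    by (simp add: power_mult_distrib power3_eq_cube power2_eq_square power4_eq_xxxx mult_ac del: of_nat_Suc)
  finally show ?thesis .
qed

section \<open>Separately polynomial functions on the cube\<close>

interpretation unif_interval: prob_space unif_interval
  by (rule prob_space_uniform_measure) auto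

interpretation unif_product: product_sigma_finite "\<lambda>_::nat. unif_interval"
  by (simp add: product_sigma_finite_def unif_interval.sigma_finite_measure_axioms)

interpretation lborel_product: product_sigma_finite "\<lambda>_::nat. lborel :: real measure"
  by (simp add: product_sigma_finite_def lborel.sigma_finite_measure_axioms)

lemma sets_unif_cube: "sets (\<Pi>\<^sub>M i\<in>J. unif_interval) = sets (\<Pi>\<^sub>M i\<in>J. lborel)"
  by (intro sets_PiM_cong) auto

lemma emeasure_lborel_box:
  "emeasure (\<Pi>\<^sub>M i\<in>{..<n}. lborel) (\<Pi>\<^sub>E i\<in>{..<n}. {a i..<a i + d}) = ennreal (d ^ n)" if "0 \<le> d"
  for a :: "nat \<Rightarrow> real"
  using that by (subst lborel_product.emeasure_PiM) (auto simp: ennreal_power)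

text \<open>Brings the mean square in \<open>l2_norm\<close> within reach of Fubini. The two
  measures agree on boxes because the normalising volume 2^n splits into one factor 2 per
  coordinate.\<close>

lemma uniform_on_cube_eq_PiM: "uniform_on_cube n {-1..1} = (\<Pi>\<^sub>M i\<in>{..<n}. unif_interval)"
  unfolding uniform_on_cube_def
proof (rule unif_product.PiM_eqI)
  show "sets (uniform_measure (\<Pi>\<^sub>M i\<in>{..<n}. lborel) (\<Pi>\<^sub>E i\<in>{..<n}. {-1..1})) = sets (\<Pi>\<^sub>M i\<in>{..<n}. unif_interval)"
    by (simp add: sets_unif_cube)
next
  fix A :: "nat \<Rightarrow> real set" assume "\<And>i. i \<in> {..<n} \<Longrightarrow> A i \<in> sets unif_interval"
  then have A [measurable]: "\<And>i. i \<in> {..<n} \<Longrightarrow> A i \<in> sets borel" by simp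
  have "emeasure (uniform_measure (\<Pi>\<^sub>M i\<in>{..<n}. lborel) (\<Pi>\<^sub>E i\<in>{..<n}. {-1..1})) (Pi\<^sub>E {..<n} A)
    = emeasure (\<Pi>\<^sub>M i\<in>{..<n}. lborel) (\<Pi>\<^sub>E i\<in>{..<n}. {-1..1} \<inter> A i)
      / emeasure (\<Pi>\<^sub>M i\<in>{..<n}. lborel) (\<Pi>\<^sub>E i\<in>{..<n}. {-1..1::real})"
    by (subst emeasure_uniform_measure) (auto simp: PiE_Int intro!: sets_PiM_I_finite A)
  also have "\<dots> = (\<Prod>i<n. emeasure lborel ({-1..1} \<inter> A i)) / (\<Prod>i<n. 2)"
    by (subst (1 2) lborel_product.emeasure_PiM) (use A in auto)
  also have "\<dots> = (\<Prod>i<n. emeasure lborel ({-1..1} \<inter> A i) / 2)"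
    by (simp add: divide_ennreal_def prod.distrib ennreal_inverse_power)
  also have "\<dots> = (\<Prod>i<n. emeasure unif_interval (A i))"
    by (intro prod.cong refl) (use A in \<open>auto simp: emeasure_uniform_measure\<close>)
  finally show "emeasure (uniform_measure (\<Pi>\<^sub>M i\<in>{..<n}. lborel) (\<Pi>\<^sub>E i\<in>{..<n}. {-1..1})) (Pi\<^sub>E {..<n} A)
     = (\<Prod>i<n. emeasure unif_interval (A i))" .
qed simp

section \<open>Sup and Lipschitz estimates on the cube, one coordinate at a time\<close>

definition separately_poly :: "nat \<Rightarrow> nat set \<Rightarrow> ((nat \<Rightarrow> real) \<Rightarrow> real) \<Rightarrow> bool" where
  "separately_poly r J g \<longleftrightarrow>
    (\<forall>x. \<forall>i\<in>J. \<exists>P. degree P \<le> r \<and> (\<forall>t. g (x(i := t)) = poly P t))"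

text \<open>Drives the induction over coordinates: a slice stays in the class, with one coordinate
  fewer and the same degree bound.\<close>

lemma separately_poly_fix:
  assumes "separately_poly r (insert i J) g" "i \<notin> J"
  shows "separately_poly r J (\<lambda>y. g (y(i := t)))"
  unfolding separately_poly_def
proof (intro allI ballI)
  fix x j assume "j \<in> J"
  with assms(2) have "x(j := u, i := t) = x(i := t, j := u)" for u
    by (auto simp: fun_upd_twist)
  with assms(1) \<open>j \<in> J\<close> show "\<exists>P. degree P \<le> r \<and> (\<forall>u. g (x(j := u, i := t)) = poly P u)"
    unfolding separately_poly_def by simp
qed

lemma measurable_fix_coordinate:
  assumes "g \<in> borel_measurable (\<Pi>\<^sub>M i\<in>insert i J. unif_interval)"
  shows "(\<lambda>y. g (y(i := t))) \<in> borel_measurable (\<Pi>\<^sub>M i\<in>J. unif_interval)"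
proof -
  have "(\<lambda>y. y(i := t)) \<in> measurable (\<Pi>\<^sub>M i\<in>J. unif_interval) (\<Pi>\<^sub>M i\<in>insert i J. unif_interval)"
    by (rule measurable_fun_upd[where J = J]) auto
  from measurable_compose[OF this assms] show ?thesis .
qed

abbreviation cube_L2sq :: "nat set \<Rightarrow> ((nat \<Rightarrow> real) \<Rightarrow> real) \<Rightarrow> ennreal" where
  "cube_L2sq J g \<equiv> (\<integral>\<^sup>+x. ennreal ((g x)\<^sup>2) \<partial>(\<Pi>\<^sub>M i\<in>J. unif_interval))"

lemma cube_L2sq_insert:
  assumes "finite J" "i \<notin> J" "g \<in> borel_measurable (\<Pi>\<^sub>M i\<in>insert i J. unif_interval)"
  shows "cube_L2sq (insert i J) g
    = (\<integral>\<^sup>+y. (\<integral>\<^sup>+s. ennreal ((g (y(i := s)))\<^sup>2) \<partial>unif_interval) \<partial>(\<Pi>\<^sub>M i\<in>J. unif_interval))"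
  using assms by (intro unif_product.product_nn_integral_insert) auto

text \<open>Integrates a univariate estimate along direction i over the remaining coordinates. Here
  \<open>h\<close> will be a slice of \<open>g\<close> for the sup bound, and a difference of two
  slices for the Lipschitz bound.\<close>

lemma cube_L2sq_fix_le:
  assumes "finite J" "i \<notin> J" "g \<in> borel_measurable (\<Pi>\<^sub>M i\<in>insert i J. unif_interval)"
    and le: "\<And>y. ennreal ((h y)\<^sup>2) \<le> ennreal K * (\<integral>\<^sup>+s. ennreal ((g (y(i := s)))\<^sup>2) \<partial>unif_interval)"
  shows "cube_L2sq J h \<le> ennreal K * cube_L2sq (insert i J) g"
proof -
  have "(\<lambda>(y, s). y(i := s)) \<in> measurable ((\<Pi>\<^sub>M i\<in>J. unif_interval) \<Otimes>\<^sub>M unif_interval) (\<Pi>\<^sub>M i\<in>insert i J. unif_interval)"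
    by measurable
  from measurable_compose[OF this assms(3)]
  have m: "(\<lambda>(y, s). ennreal ((g (y(i := s)))\<^sup>2)) \<in> borel_measurable ((\<Pi>\<^sub>M i\<in>J. unif_interval) \<Otimes>\<^sub>M unif_interval)"
    by (simp add: case_prod_unfold)
  have "cube_L2sq J h \<le> (\<integral>\<^sup>+y. ennreal K * (\<integral>\<^sup>+s. ennreal ((g (y(i := s)))\<^sup>2) \<partial>unif_interval) \<partial>(\<Pi>\<^sub>M i\<in>J. unif_interval))"
    by (intro nn_integral_mono le)
  also have "\<dots> = ennreal K * cube_L2sq (insert i J) g"
    unfolding cube_L2sq_insert[OF assms(1-3)]
    by (intro nn_integral_cmult unif_interval.borel_measurable_nn_integral m)
  finally show ?thesis .
qed

text \<open>The factor of \<open>poly_sup_le_L2\<close>; every coordinate handled through Fubini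
  costs one such factor.\<close>

definition sup_L2_const :: "nat \<Rightarrow> real" where
  "sup_L2_const r = 2 * real (Suc r) ^ 3"

lemma sup_L2_const_nonneg: "0 \<le> sup_L2_const r"
  by (simp add: sup_L2_const_def)

text \<open>Freeze one coordinate at \<open>x i\<close> and apply the induction hypothesis to the
  slice; the univariate sup bound, averaged over the other coordinates, bounds the mean square of
  that slice by that of \<open>g\<close>.\<close>

lemma separately_poly_sup_le_L2:
  assumes "finite J" "separately_poly r J g" "g \<in> borel_measurable (\<Pi>\<^sub>M i\<in>J. unif_interval)"
    and "x \<in> (\<Pi>\<^sub>E i\<in>J. {-1..1})"
  shows "ennreal ((g x)\<^sup>2) \<le> ennreal (sup_L2_const r ^ card J) * cube_L2sq J g"
  using assms
proof (induction J arbitrary: g x rule: finite_induct)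
  case empty
  then show ?case by (simp add: PiM_empty nn_integral_count_space_finite)
next
  case (insert i J)
  define y where "y = restrict x J"
  have y: "y \<in> (\<Pi>\<^sub>E i\<in>J. {-1..1})" and xi: "\<bar>x i\<bar> \<le> 1" and xy: "x = y(i := x i)"
    using insert.prems(3) insert.hyps by (auto simp: y_def PiE_iff extensional_def fun_eq_iff abs_le_iff)
  let ?h = "\<lambda>y. g (y(i := x i))"
  have "ennreal ((g x)\<^sup>2) = ennreal ((?h y)\<^sup>2)" using xy by metis
  also have "\<dots> \<le> ennreal (sup_L2_const r ^ card J) * cube_L2sq J ?h"
    by (rule insert.IH[OF separately_poly_fix measurable_fix_coordinate y]) fact+
  also have "\<dots> \<le> ennreal (sup_L2_const r ^ card J) * (ennreal (sup_L2_const r) * cube_L2sq (insert i J) g)"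
  proof (intro mult_left_mono cube_L2sq_fix_le insert)
    fix y
    obtain P where "degree P \<le> r" "\<And>t. g (y(i := t)) = poly P t"
      using insert.prems(1) unfolding separately_poly_def by blast
    with poly_sup_le_L2[OF this(1) xi]
    show "ennreal ((?h y)\<^sup>2) \<le> ennreal (sup_L2_const r) * (\<integral>\<^sup>+s. ennreal ((g (y(i := s)))\<^sup>2) \<partial>unif_interval)"
      by (simp add: sup_L2_const_def)
  qed simp
  also have "\<dots> = ennreal (sup_L2_const r ^ card (insert i J)) * cube_L2sq (insert i J) g"
    using insert.hyps by (simp add: ennreal_mult sup_L2_const_nonneg mult_ac)
  finally show ?case .
qed

lemma separately_poly_diff:
  assumes "separately_poly r J g" "separately_poly r J h"
  shows "separately_poly r J (\<lambda>x. g x - h x)"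
  unfolding separately_poly_def
proof (intro allI ballI)
  fix x i assume "i \<in> J"
  then obtain P Q where "degree P \<le> r" "\<And>t. g (x(i := t)) = poly P t" "degree Q \<le> r" "\<And>t. h (x(i := t)) = poly Q t"
    using assms unfolding separately_poly_def by meson
  then show "\<exists>P. degree P \<le> r \<and> (\<forall>t. g (x(i := t)) - h (x(i := t)) = poly P t)"
    by (intro exI[of _ "P - Q"]) (simp add: degree_diff_le)
qed

text \<open>The change of \<open>g\<close> in direction i is a difference of two slices, hence
  separately polynomial in the other coordinates. The sup bound there costs card J - 1 factors; the
  univariate Lipschitz bound costs the last one together with r^4 (t - x i)^2.\<close>

lemma separately_poly_coordinate_step:
  assumes "finite J" "i \<in> J" "separately_poly r J g" "g \<in> borel_measurable (\<Pi>\<^sub>M i\<in>J. unif_interval)"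
    and x: "x \<in> (\<Pi>\<^sub>E i\<in>J. {-1..1})" and t: "\<bar>t\<bar> \<le> 1"
  shows "ennreal ((g (x(i := t)) - g x)\<^sup>2) \<le> ennreal (sup_L2_const r ^ card J * real r ^ 4 * (t - x i)\<^sup>2) * cube_L2sq J g"
proof -
  define I where "I = J - {i}"
  have J: "J = insert i I" and I: "finite I" "i \<notin> I" using assms(1,2) by (auto simp: I_def)
  define y where "y = restrict x I"
  have y: "y \<in> (\<Pi>\<^sub>E i\<in>I. {-1..1})" and xi: "\<bar>x i\<bar> \<le> 1" and xy: "x = y(i := x i)"
    using x I by (auto simp: J y_def PiE_iff extensional_def fun_eq_iff abs_le_iff)
  let ?h = "\<lambda>y. g (y(i := t)) - g (y(i := x i))"
  let ?K = "sup_L2_const r * real r ^ 4 * (t - x i)\<^sup>2"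
  have K: "0 \<le> ?K" by (simp add: sup_L2_const_nonneg)
  have "ennreal ((g (x(i := t)) - g x)\<^sup>2) = ennreal ((?h y)\<^sup>2)" using xy by (metis fun_upd_upd)
  also have "\<dots> \<le> ennreal (sup_L2_const r ^ card I) * cube_L2sq I ?h"
    using assms(3,4) I y unfolding J
    by (intro separately_poly_sup_le_L2 separately_poly_diff borel_measurable_diff
        separately_poly_fix measurable_fix_coordinate)
  also have "\<dots> \<le> ennreal (sup_L2_const r ^ card I) * (ennreal ?K * cube_L2sq J g)"
    unfolding J
  proof (intro mult_left_mono cube_L2sq_fix_le I)
    show "g \<in> borel_measurable (\<Pi>\<^sub>M i\<in>insert i I. unif_interval)" using assms(4) J by simp
    fix y
    obtain P where "degree P \<le> r" "\<And>t. g (y(i := t)) = poly P t"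
      using assms(2,3) unfolding separately_poly_def by blast
    with poly_lipschitz_le_L2[OF this(1) t xi]
    show "ennreal ((?h y)\<^sup>2) \<le> ennreal ?K * (\<integral>\<^sup>+s. ennreal ((g (y(i := s)))\<^sup>2) \<partial>unif_interval)"
      by (simp add: sup_L2_const_def)
  qed simp
  also have "\<dots> = ennreal (sup_L2_const r ^ card I * ?K) * cube_L2sq J g"
    by (subst ennreal_mult[OF zero_le_power[OF sup_L2_const_nonneg] K]) (rule mult.assoc[symmetric])
  also have "sup_L2_const r ^ card I * ?K = sup_L2_const r ^ card J * real r ^ 4 * (t - x i)\<^sup>2"
    using I by (simp add: J mult_ac)
  finally show ?thesis .
qed

text \<open>A positive norm already forces integrability, since the Bochner integral of a
  non-integrable function is 0. So the nonnegative integral is finite and equals the squared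
  norm.\<close>

lemma l2_norm_eq_cube_L2sq:
  assumes "0 < l2_norm m g"
  shows "cube_L2sq {..<m} g = ennreal ((l2_norm m g)\<^sup>2)"
proof -
  let ?I = "\<integral>x. (g x)\<^sup>2 \<partial>(\<Pi>\<^sub>M i\<in>{..<m}. unif_interval)"
  have norm: "l2_norm m g = sqrt ?I"
    by (simp add: l2_norm_def uniform_on_cube_eq_PiM)
  with assms have "?I \<noteq> 0" by auto
  then have "integrable (\<Pi>\<^sub>M i\<in>{..<m}. unif_interval) (\<lambda>x. (g x)\<^sup>2)"
    using not_integrable_integral_eq by blast
  then have "cube_L2sq {..<m} g = ennreal ?I"
    by (intro nn_integral_eq_integral) auto
  then show ?thesis by (simp add: norm)
qed

lemma separately_poly_close:
  assumes g: "separately_poly r {..<m} g" "g \<in> borel_measurable (\<Pi>\<^sub>M i\<in>{..<m}. unif_interval)"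
    and norm: "0 < l2_norm m g" "l2_norm m g \<le> 1" and "0 \<le> \<delta>"
    and x: "x \<in> (\<Pi>\<^sub>E i\<in>{..<m}. {-1..1})" and y: "y \<in> (\<Pi>\<^sub>E i\<in>{..<m}. {-1..1})"
    and d: "\<And>i. i < m \<Longrightarrow> \<bar>y i - x i\<bar> \<le> \<delta>"
  shows "\<bar>g y - g x\<bar> \<le> real m * (sqrt (sup_L2_const r ^ m) * (real r)\<^sup>2 * \<delta>)"
proof -
  let ?L = "sqrt (sup_L2_const r ^ m) * (real r)\<^sup>2 * \<delta>"
  have L: "0 \<le> ?L" using \<open>0 \<le> \<delta>\<close> by (simp add: sup_L2_const_nonneg)
  \<comment> \<open>A path from x to y that replaces one coordinate per step: the first k
    coordinates come from y, the rest from x. Each step contributes at most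
    \<open>?L\<close>.\<close>
  define z where "z k = (\<lambda>i. if i < k then y i else x i)" for k
  have z: "z k \<in> (\<Pi>\<^sub>E i\<in>{..<m}. {-1..1})" for k
    using x y by (auto simp: z_def PiE_iff extensional_def)
  have step: "\<bar>g (z (Suc k)) - g (z k)\<bar> \<le> ?L" if "k < m" for k
  proof -
    have zk: "z (Suc k) = (z k)(k := y k)" "z k k = x k" by (auto simp: z_def fun_eq_iff)
    have "\<bar>y k\<bar> \<le> 1" using y that by (auto simp: PiE_iff abs_le_iff)
    from separately_poly_coordinate_step[OF _ _ g z[of k] this, of k] that
    have "ennreal ((g (z (Suc k)) - g (z k))\<^sup>2) \<le> ennreal (sup_L2_const r ^ m * real r ^ 4 * (y k - x k)\<^sup>2) * ennreal ((l2_norm m g)\<^sup>2)"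
      by (simp add: zk l2_norm_eq_cube_L2sq[OF norm(1)])
    also have "\<dots> = ennreal (sup_L2_const r ^ m * real r ^ 4 * (y k - x k)\<^sup>2 * (l2_norm m g)\<^sup>2)"
      by (subst ennreal_mult) (auto simp: sup_L2_const_nonneg)
    finally have "(g (z (Suc k)) - g (z k))\<^sup>2 \<le> sup_L2_const r ^ m * real r ^ 4 * (y k - x k)\<^sup>2 * (l2_norm m g)\<^sup>2"
      by (subst (asm) ennreal_le_iff) (auto simp: sup_L2_const_nonneg)
    also have "\<dots> \<le> sup_L2_const r ^ m * real r ^ 4 * \<delta>\<^sup>2 * 1"
      using d[OF that] norm \<open>0 \<le> \<delta>\<close>
      by (intro mult_mono) (auto simp: sup_L2_const_nonneg abs_le_square_iff[symmetric] power_le_one)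
    also have "\<dots> = ?L\<^sup>2"
      by (simp add: power_mult_distrib sup_L2_const_nonneg flip: power_mult)
    finally have "\<bar>g (z (Suc k)) - g (z k)\<bar> \<le> \<bar>?L\<bar>" by (simp only: abs_le_square_iff)
    then show ?thesis by (simp only: abs_of_nonneg[OF L])
  qed
  have "\<bar>g (z k) - g (z 0)\<bar> \<le> real k * ?L" if "k \<le> m" for k
    using that
  proof (induction k)
    case (Suc k)
    then show ?case using step[of k] by (simp add: algebra_simps)
  qed simp
  moreover have "z m = y" "z 0 = x" using x y by (auto simp: z_def fun_eq_iff PiE_iff extensional_def)
  ultimately show ?thesis by blast
qed

text \<open>Put B = 16 n r^2. As r + 1 is at most 2 r, the constant is at most 16 r^3, hence at most
  B^2, so its square root costs at most B per coordinate and B^(2n) in all. The remaining 2 n r^2 is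
  B / 8, below the permitted B / 2.\<close>

lemma sup_L2_const_le:
  assumes "0 < r" "0 < n" "0 \<le> \<delta>"
  shows "real (2 * n) * (sqrt (sup_L2_const r ^ (2 * n)) * (real r)\<^sup>2 * \<delta>)
    \<le> 1 / 2 * \<delta> * (16 * real n * (real r)\<^sup>2) ^ (2 * n + 1)"
proof -
  let ?B = "16 * real n * (real r)\<^sup>2"
  have r: "1 \<le> real r" "1 \<le> real n" using assms by auto
  have n2: "1 \<le> 16 * (real n)\<^sup>2" using one_le_power[OF r(2), of 2] by linarith
  have "sup_L2_const r \<le> 2 * (2 * real r) ^ 3"
    unfolding sup_L2_const_def using r by (intro mult_left_mono power_mono) auto
  also have "\<dots> = 16 * (real r) ^ 3" by (simp add: power_mult_distrib)
  also have "\<dots> \<le> 16 * real r ^ 4" using r by (intro mult_left_mono power_increasing) auto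
  also have "\<dots> \<le> (16 * real r ^ 4) * (16 * (real n)\<^sup>2)"
    using mult_left_mono[OF n2, of "16 * real r ^ 4"] by simp
  also have "\<dots> = ?B\<^sup>2" by (simp add: power_mult_distrib flip: power_mult)
  finally have "sqrt (sup_L2_const r ^ (2 * n)) \<le> sqrt ((?B\<^sup>2) ^ (2 * n))"
    by (intro real_sqrt_le_mono power_mono sup_L2_const_nonneg)
  also have "\<dots> = ?B ^ (2 * n)"
    using r by (subst power_mult[symmetric], subst mult.commute, subst power_mult) simp
  finally have "real (2 * n) * (sqrt (sup_L2_const r ^ (2 * n)) * (real r)\<^sup>2 * \<delta>) \<le> real (2 * n) * (?B ^ (2 * n) * (real r)\<^sup>2 * \<delta>)"
    using assms by (intro mult_left_mono mult_right_mono) auto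
  also have "\<dots> = 1 / 8 * (\<delta> * ?B ^ (2 * n + 1))" by simp
  also have "\<dots> \<le> 1 / 2 * (\<delta> * ?B ^ (2 * n + 1))"
    using assms by (intro mult_right_mono) auto
  finally show ?thesis by simp
qed

section \<open>Polynomial functions and their real and imaginary parts\<close>

definition monom_eval :: "(nat \<Rightarrow>\<^sub>0 nat) \<Rightarrow> (nat \<Rightarrow> 'a::comm_semiring_1) \<Rightarrow> 'a" where
  "monom_eval m x = (\<Prod>i\<in>Poly_Mapping.keys m. x i ^ Poly_Mapping.lookup m i)"

text \<open>Extra indices only contribute factors with exponent 0. This puts monomials with
  different supports over a common index set.\<close>

lemma monom_eval_superset:
  assumes "finite S" "Poly_Mapping.keys m \<subseteq> S"
  shows "monom_eval m x = (\<Prod>i\<in>S. x i ^ Poly_Mapping.lookup m i)"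
  unfolding monom_eval_def using assms
  by (intro prod.mono_neutral_left) (auto simp: in_keys_iff)

lemma monom_degree_superset:
  assumes "finite S" "Poly_Mapping.keys m \<subseteq> S"
  shows "monom_degree m = (\<Sum>i\<in>S. Poly_Mapping.lookup m i)"
  unfolding monom_degree_def using assms
  by (intro sum.mono_neutral_left) (auto simp: in_keys_iff)

lemma monom_eval_add: "monom_eval (m + k) x = monom_eval m x * monom_eval k x"
proof -
  let ?S = "Poly_Mapping.keys m \<union> Poly_Mapping.keys k"
  have "Poly_Mapping.keys (m + k) \<subseteq> ?S" by (rule Poly_Mapping.keys_add)
  then show ?thesis
    by (simp add: monom_eval_superset[of ?S] lookup_add power_add prod.distrib)
qed

lemma monom_degree_add: "monom_degree (m + k) = monom_degree m + monom_degree k"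
proof -
  let ?S = "Poly_Mapping.keys m \<union> Poly_Mapping.keys k"
  have "Poly_Mapping.keys (m + k) \<subseteq> ?S" by (rule Poly_Mapping.keys_add)
  then show ?thesis
    by (simp add: monom_degree_superset[of ?S] lookup_add sum.distrib)
qed

lemma monom_eval_upd:
  "monom_eval m (x(i := t)) = (\<Prod>j\<in>Poly_Mapping.keys m - {i}. x j ^ Poly_Mapping.lookup m j) * t ^ Poly_Mapping.lookup m i"
proof -
  have "monom_eval m (x(i := t)) = (\<Prod>j\<in>insert i (Poly_Mapping.keys m). (x(i := t)) j ^ Poly_Mapping.lookup m j)"
    by (rule monom_eval_superset) auto
  then show ?thesis by (simp add: prod.insert_remove mult.commute)
qed

lemma lookup_le_monom_degree: "Poly_Mapping.lookup m i \<le> monom_degree m"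
proof -
  have "monom_degree m = (\<Sum>j\<in>insert i (Poly_Mapping.keys m). Poly_Mapping.lookup m j)"
    by (rule monom_degree_superset) auto
  then show ?thesis by (simp add: sum.insert_remove)
qed

lemma poly_eval_superset:
  assumes "finite S" "Poly_Mapping.keys p \<subseteq> S"
  shows "poly_eval p x = (\<Sum>m\<in>S. Poly_Mapping.lookup p m * monom_eval m x)"
  unfolding poly_eval_def monom_eval_def[symmetric] using assms
  by (intro sum.mono_neutral_left) (auto simp: in_keys_iff)

lemma poly_eval_add: "poly_eval (p + q) x = poly_eval p x + poly_eval q x"
proof -
  let ?S = "Poly_Mapping.keys p \<union> Poly_Mapping.keys q"
  have "Poly_Mapping.keys (p + q) \<subseteq> ?S" by (rule Poly_Mapping.keys_add)
  then show ?thesis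
    by (simp add: poly_eval_superset[of ?S] lookup_add distrib_right sum.distrib)
qed

lemma poly_eval_single: "poly_eval (Poly_Mapping.single m c) x = c * monom_eval m x"
  by (subst poly_eval_superset[of "{m}"]) (auto simp: lookup_single)

lemma total_degree_le_iff: "total_degree p \<le> d \<longleftrightarrow> (\<forall>m\<in>Poly_Mapping.keys p. monom_degree m \<le> d)"
  unfolding total_degree_def by (subst Max_le_iff) auto

text \<open>Works with functions instead of coefficient maps: the Carbery-Wright property only asks
  that some map of the right degree represent the function, and closure under the ring operations
  provides one.\<close>

definition poly_functions :: "nat \<Rightarrow> nat \<Rightarrow> ((nat \<Rightarrow> real) \<Rightarrow> real) set" where
  "poly_functions N d = {poly_eval p | p. polynomial_in N p \<and> total_degree p \<le> d}"

lemma poly_functions_add: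
  assumes "g \<in> poly_functions N d" "h \<in> poly_functions N d"
  shows "(\<lambda>x. g x + h x) \<in> poly_functions N d"
proof -
  obtain p q where p: "g = poly_eval p" "polynomial_in N p" "total_degree p \<le> d"
    and q: "h = poly_eval q" "polynomial_in N q" "total_degree q \<le> d"
    using assms unfolding poly_functions_def by auto
  have keys: "m \<in> Poly_Mapping.keys p \<or> m \<in> Poly_Mapping.keys q" if "m \<in> Poly_Mapping.keys (p + q)" for m
    using that Poly_Mapping.keys_add[of p q] by blast
  have "polynomial_in N (p + q)" "total_degree (p + q) \<le> d"
    using p q keys unfolding total_degree_le_iff polynomial_in_def by meson+
  then show ?thesis unfolding poly_functions_def p q
    by (intro CollectI exI[of _ "p + q"]) (auto simp: poly_eval_add)
qed

lemma poly_functions_monom: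
  assumes "Poly_Mapping.keys m \<subseteq> {..<N}" "monom_degree m \<le> d"
  shows "(\<lambda>x. c * monom_eval m x) \<in> poly_functions N d"
  unfolding poly_functions_def using assms
  by (intro CollectI exI[of _ "Poly_Mapping.single m c"])
    (auto simp: fun_eq_iff poly_eval_single total_degree_le_iff polynomial_in_def)

lemma poly_functions_const: "(\<lambda>x. c) \<in> poly_functions N d"
  using poly_functions_monom[of 0 N d c] by (simp add: monom_eval_def monom_degree_def)

lemma poly_functions_sum:
  assumes "\<And>s. s \<in> S \<Longrightarrow> h s \<in> poly_functions N d"
  shows "(\<lambda>x. \<Sum>s\<in>S. h s x) \<in> poly_functions N d"
  using assms
  by (induction S rule: infinite_finite_induct) (auto intro: poly_functions_add poly_functions_const)

lemma poly_functions_mono: "d \<le> e \<Longrightarrow> poly_functions N d \<subseteq> poly_functions N e"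
  by (auto simp: poly_functions_def)

lemma poly_functions_var: "j < N \<Longrightarrow> (\<lambda>x. x j) \<in> poly_functions N 1"
  using poly_functions_monom[of "Poly_Mapping.single j 1" N 1 1]
  by (simp add: monom_eval_def monom_degree_def)

lemma poly_functions_mult:
  assumes "g \<in> poly_functions N d" "h \<in> poly_functions N e"
  shows "(\<lambda>x. g x * h x) \<in> poly_functions N (d + e)"
proof -
  obtain p q where p: "g = poly_eval p" "polynomial_in N p" "total_degree p \<le> d"
    and q: "h = poly_eval q" "polynomial_in N q" "total_degree q \<le> e"
    using assms unfolding poly_functions_def by auto
  have "(\<lambda>x. g x * h x) = (\<lambda>x. \<Sum>m\<in>Poly_Mapping.keys p. \<Sum>k\<in>Poly_Mapping.keys q.
      (Poly_Mapping.lookup p m * Poly_Mapping.lookup q k) * monom_eval (m + k) x)"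
    unfolding p q poly_eval_def monom_eval_def[symmetric] monom_eval_add sum_product
    by (simp only: mult_ac)
  also have "\<dots> \<in> poly_functions N (d + e)"
  proof (intro poly_functions_sum poly_functions_monom)
    fix m k assume mk: "m \<in> Poly_Mapping.keys p" "k \<in> Poly_Mapping.keys q"
    show "Poly_Mapping.keys (m + k) \<subseteq> {..<N}"
      using mk p q Poly_Mapping.keys_add[of m k] unfolding polynomial_in_def by blast
    show "monom_degree (m + k) \<le> d + e"
      using mk p q by (simp add: monom_degree_add total_degree_le_iff add_mono)
  qed
  finally show ?thesis .
qed

lemma poly_functions_diff:
  assumes "g \<in> poly_functions N d" "h \<in> poly_functions N d"
  shows "(\<lambda>x. g x - h x) \<in> poly_functions N d"
proof -
  have "(\<lambda>x. -1 * h x) \<in> poly_functions N (0 + d)"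
    by (intro poly_functions_mult poly_functions_const assms(2))
  then show ?thesis using poly_functions_add[OF assms(1), of "\<lambda>x. -1 * h x"] by simp
qed

section \<open>Real and imaginary parts as real polynomials in 2n variables\<close>

definition complex_poly_functions :: "nat \<Rightarrow> nat \<Rightarrow> ((nat \<Rightarrow> real) \<Rightarrow> complex) set" where
  "complex_poly_functions N d =
    {h. (\<lambda>x. Re (h x)) \<in> poly_functions N d \<and> (\<lambda>x. Im (h x)) \<in> poly_functions N d}"

lemma complex_poly_functions_const: "(\<lambda>x. c) \<in> complex_poly_functions N d"
  by (simp add: complex_poly_functions_def poly_functions_const)

lemma complex_poly_functions_sum:
  assumes "\<And>s. s \<in> S \<Longrightarrow> h s \<in> complex_poly_functions N d"
  shows "(\<lambda>x. \<Sum>s\<in>S. h s x) \<in> complex_poly_functions N d"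
  using assms by (auto simp: complex_poly_functions_def intro: poly_functions_sum)

lemma complex_poly_functions_mult:
  assumes "g \<in> complex_poly_functions N d" "h \<in> complex_poly_functions N e"
  shows "(\<lambda>x. g x * h x) \<in> complex_poly_functions N (d + e)"
  using assms unfolding complex_poly_functions_def
  by (auto intro!: poly_functions_diff poly_functions_add poly_functions_mult)

lemma complex_poly_functions_power:
  assumes "h \<in> complex_poly_functions N 1"
  shows "(\<lambda>x. h x ^ k) \<in> complex_poly_functions N k"
proof (induction k)
  case (Suc k)
  then show ?case using complex_poly_functions_mult[OF assms Suc] by simp
qed (simp add: complex_poly_functions_const)

lemma complex_poly_functions_prod:
  assumes "finite S" "\<And>s. s \<in> S \<Longrightarrow> h s \<in> complex_poly_functions N (e s)"
  shows "(\<lambda>x. \<Prod>s\<in>S. h s x) \<in> complex_poly_functions N (\<Sum>s\<in>S. e s)"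
  using assms
  by (induction S rule: finite_induct) (auto simp: complex_poly_functions_const intro: complex_poly_functions_mult)

text \<open>Each complex variable is a degree 1 function of the 2n real variables, so expanding a
  monomial does not raise its total degree.\<close>

lemma poly_eval_complex_point_in:
  assumes "polynomial_in n f" "total_degree f \<le> r"
  shows "(\<lambda>x. poly_eval f (complex_point n x (\<lambda>i. x (n + i)))) \<in> complex_poly_functions (2 * n) r"
  unfolding poly_eval_def
proof (rule complex_poly_functions_sum)
  fix m assume m: "m \<in> Poly_Mapping.keys f"
  let ?z = "\<lambda>x. complex_point n x (\<lambda>i. x (n + i))"
  have "(\<lambda>x. ?z x i) \<in> complex_poly_functions (2 * n) 1" if "i \<in> Poly_Mapping.keys m" for i
  proof -
    have "i < n" using that m assms(1) unfolding polynomial_in_def by auto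
    then show ?thesis
      using poly_functions_var[of i "2 * n"] poly_functions_var[of "n + i" "2 * n"]
      by (simp add: complex_poly_functions_def complex_point_def)
  qed
  then have "(\<lambda>x. Poly_Mapping.lookup f m * (\<Prod>i\<in>Poly_Mapping.keys m. ?z x i ^ Poly_Mapping.lookup m i))
      \<in> complex_poly_functions (2 * n) (0 + monom_degree m)"
    unfolding monom_degree_def
    by (intro complex_poly_functions_mult complex_poly_functions_const complex_poly_functions_prod
        complex_poly_functions_power) auto
  moreover have "monom_degree m \<le> r" using assms(2) m by (simp add: total_degree_le_iff)
  ultimately show "(\<lambda>x. Poly_Mapping.lookup f m * (\<Prod>i\<in>Poly_Mapping.keys m. ?z x i ^ Poly_Mapping.lookup m i))
      \<in> complex_poly_functions (2 * n) r"
    using poly_functions_mono unfolding complex_poly_functions_def by fastforce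
qed

text \<open>With all coordinates but i frozen, a monomial becomes a constant times a power of t
  whose exponent is at most the total degree.\<close>

lemma poly_functions_separately_poly:
  assumes "g \<in> poly_functions N d"
  shows "separately_poly d J g"
proof -
  obtain p where p: "g = poly_eval p" "total_degree p \<le> d"
    using assms unfolding poly_functions_def by auto
  show ?thesis unfolding separately_poly_def
  proof (intro allI ballI)
    fix x i
    let ?P = "\<Sum>m\<in>Poly_Mapping.keys p. Polynomial.monom (Poly_Mapping.lookup p m *
      (\<Prod>j\<in>Poly_Mapping.keys m - {i}. x j ^ Poly_Mapping.lookup m j)) (Poly_Mapping.lookup m i)"
    have "degree ?P \<le> d"
    proof (intro degree_sum_le)
      fix m assume "m \<in> Poly_Mapping.keys p"
      then have "monom_degree m \<le> d" using p(2) by (simp add: total_degree_le_iff)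
      then have "Poly_Mapping.lookup m i \<le> d" using lookup_le_monom_degree[of m i] by simp
      then show "degree (Polynomial.monom (Poly_Mapping.lookup p m *
        (\<Prod>j\<in>Poly_Mapping.keys m - {i}. x j ^ Poly_Mapping.lookup m j)) (Poly_Mapping.lookup m i)) \<le> d"
        using degree_monom_le order_trans by blast
    qed simp
    moreover have "g (x(i := t)) = poly ?P t" for t
      unfolding p poly_eval_def monom_eval_def[symmetric] monom_eval_upd
      by (simp add: poly_sum poly_monom mult.assoc)
    ultimately show "\<exists>P. degree P \<le> d \<and> (\<forall>t. g (x(i := t)) = poly P t)" by blast
  qed
qed

lemma poly_functions_measurable:
  assumes "g \<in> poly_functions N d" "\<And>i. i < N \<Longrightarrow> sets (M i) = sets borel"
  shows "g \<in> borel_measurable (\<Pi>\<^sub>M i\<in>{..<N}. M i)"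
proof -
  obtain p where p: "g = poly_eval p" "polynomial_in N p"
    using assms unfolding poly_functions_def by auto
  have "(\<lambda>x. x i) \<in> borel_measurable (\<Pi>\<^sub>M i\<in>{..<N}. M i)" if "i < N" for i
    using measurable_component_singleton[of i "{..<N}" M] that assms(2)[OF that]
    by (simp cong: measurable_cong_sets)
  then show ?thesis unfolding p poly_eval_def
    using p(2) unfolding polynomial_in_def
    by (intro borel_measurable_sum borel_measurable_times borel_measurable_const borel_measurable_prod
       borel_measurable_power) blast
qed

section \<open>Discretisation\<close>

definition grid_cell :: "nat \<Rightarrow> nat \<Rightarrow> (nat \<Rightarrow> nat) \<Rightarrow> (nat \<Rightarrow> real) set" where
  "grid_cell K m J = (\<Pi>\<^sub>E i\<in>{..<m}. {-1 + real (J i) / real K ..< -1 + real (J i) / real K + 1 / real K})"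

text \<open>Since cells are half-open, rounding down recovers the index from any point of the cell;
  distinct cells are therefore disjoint.\<close>

lemma grid_cell_index_unique:
  assumes "0 < K" "v \<in> grid_cell K m J" "i < m"
  shows "J i = nat \<lfloor>(v i + 1) * real K\<rfloor>"
proof -
  have "-1 + real (J i) / real K \<le> v i" "v i < -1 + real (J i) / real K + 1 / real K"
    using assms(2,3) unfolding grid_cell_def by (auto simp: PiE_iff)
  then have "real (J i) \<le> (v i + 1) * real K" "(v i + 1) * real K < real (J i) + 1"
    using assms(1) by (simp_all add: field_simps)
  then have "\<lfloor>(v i + 1) * real K\<rfloor> = int (J i)" by (simp add: floor_eq_iff)
  then show ?thesis by simp
qed

lemma grid_cell_subset_cube:
  assumes "0 < K" "J \<in> (\<Pi>\<^sub>E i\<in>{..<m}. {..<2 * K})"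
  shows "grid_cell K m J \<subseteq> (\<Pi>\<^sub>E i\<in>{..<m}. {-1..<1})"
  unfolding grid_cell_def
proof (rule PiE_mono)
  fix i assume "i \<in> {..<m}"
  then have "J i < 2 * K" using assms(2) by auto
  then have "real (J i) + 1 \<le> 2 * real K" by linarith
  then have "-1 + real (J i) / real K + 1 / real K \<le> 1"
    using assms(1) by (simp add: field_simps)
  then show "{-1 + real (J i) / real K ..< -1 + real (J i) / real K + 1 / real K} \<subseteq> {-1..<1}"
    by auto
qed

text \<open>The cells indexed by \<open>B\<close> are disjoint, have volume K^(-m) each and lie in a
  cube of volume 2^m, so together they fill exactly the fraction on the left, all of it inside
  \<open>Q\<close>.\<close>

lemma grid_fraction_le_cube_prob:
  assumes K: "0 < K" and Q: "Q \<in> sets (\<Pi>\<^sub>M i\<in>{..<m}. lborel)"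
    and B: "B \<subseteq> (\<Pi>\<^sub>E i\<in>{..<m}. {..<2 * K})" "\<And>J. J \<in> B \<Longrightarrow> grid_cell K m J \<subseteq> Q"
  shows "real (card B) / real (2 * K) ^ m \<le> measure (uniform_on_cube m {-1..<1}) Q"
proof -
  let ?L = "\<Pi>\<^sub>M i\<in>{..<m}. (lborel :: real measure)"
  let ?C = "\<Pi>\<^sub>E i\<in>{..<m}. {-1..<1::real}"
  have "finite B" by (rule finite_subset[OF B(1)]) (auto intro: finite_PiE)
  have C: "emeasure ?L ?C = ennreal (2 ^ m)"
    using emeasure_lborel_box[of 2 m "\<lambda>_. -1"] by simp
  have cell: "emeasure ?L (grid_cell K m J) = ennreal ((1 / real K) ^ m)" for J
    unfolding grid_cell_def by (rule emeasure_lborel_box) simp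
  have sets: "grid_cell K m J \<in> sets ?L" for J
    unfolding grid_cell_def by (intro sets_PiM_I_finite) auto
  have setC: "?C \<in> sets ?L" by (intro sets_PiM_I_finite) auto
  have disj: "disjoint_family_on (grid_cell K m) B"
    unfolding disjoint_family_on_def
  proof (intro ballI impI, rule ccontr)
    fix J J' assume J: "J \<in> B" "J' \<in> B" "J \<noteq> J'" "grid_cell K m J \<inter> grid_cell K m J' \<noteq> {}"
    then obtain v where "v \<in> grid_cell K m J" "v \<in> grid_cell K m J'" by blast
    then have "J i = J' i" if "i < m" for i using grid_cell_index_unique[OF K] that by metis
    moreover have "J \<in> (\<Pi>\<^sub>E i\<in>{..<m}. {..<2 * K})" "J' \<in> (\<Pi>\<^sub>E i\<in>{..<m}. {..<2 * K})"
      using J B(1) by auto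
    ultimately have "J = J'" by (metis PiE_ext lessThan_iff)
    with J show False by simp
  qed
  have "ennreal (real (card B) * (1 / real K) ^ m) = (\<Sum>J\<in>B. emeasure ?L (grid_cell K m J))"
    by (simp add: cell ennreal_mult ennreal_of_nat_eq_real_of_nat)
  also have "\<dots> = emeasure ?L (\<Union>J\<in>B. grid_cell K m J)"
    using \<open>finite B\<close> disj sets by (intro sum_emeasure) auto
  also have "\<dots> \<le> emeasure ?L (?C \<inter> Q)"
    using grid_cell_subset_cube[OF K] B Q setC by (intro emeasure_mono) blast+
  finally have "ennreal (real (card B) * (1 / real K) ^ m) \<le> emeasure ?L (?C \<inter> Q)" .
  moreover have fin: "emeasure ?L (?C \<inter> Q) \<noteq> \<infinity>"
    using emeasure_mono[of "?C \<inter> Q" ?C ?L] setC C by (auto simp: top_unique)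
  ultimately have le: "real (card B) * (1 / real K) ^ m \<le> measure ?L (?C \<inter> Q)"
    by (simp add: emeasure_eq_ennreal_measure)
  have "real (card B) / real (2 * K) ^ m = real (card B) * (1 / real K) ^ m / 2 ^ m"
    by (simp add: power_mult_distrib power_divide)
  also have "\<dots> \<le> measure ?L (?C \<inter> Q) / 2 ^ m"
    using le by (intro divide_right_mono) auto
  also have "\<dots> = measure (uniform_on_cube m {-1..<1}) Q"
    unfolding uniform_on_cube_def
    by (subst measure_uniform_measure) (use C Q in \<open>auto simp: measure_def\<close>)
  finally show ?thesis .
qed

section \<open>The complex grid parametrised by 2n integer indices, real parts first\<close>

definition grid_point :: "nat \<Rightarrow> nat \<Rightarrow> (nat \<Rightarrow> nat) \<Rightarrow> nat \<Rightarrow> complex" where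
  "grid_point K n J = complex_point n (\<lambda>i. -1 + real (J i) / real K) (\<lambda>i. -1 + real (J (n + i)) / real K)"

lemma inj_on_grid_point:
  assumes "0 < K"
  shows "inj_on (grid_point K n) (\<Pi>\<^sub>E i\<in>{..<2 * n}. S)"
proof (rule inj_onI)
  fix J J' assume J: "J \<in> (\<Pi>\<^sub>E i\<in>{..<2 * n}. S)" "J' \<in> (\<Pi>\<^sub>E i\<in>{..<2 * n}. S)"
    and eq: "grid_point K n J = grid_point K n J'"
  have *: "J i = J' i \<and> J (n + i) = J' (n + i)" if "i < n" for i
    using fun_cong[OF eq, of i] that assms
    by (simp add: grid_point_def complex_point_def complex_eq_iff)
  show "J = J'"
  proof (rule PiE_ext[OF J])
    fix i assume "i \<in> {..<2 * n}"
    then consider "i < n" | "i = n + (i - n)" "i - n < n" by force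
    then show "J i = J' i" using * by cases metis+
  qed
qed

lemma real_grid_eq:
  assumes "0 < K"
  shows "real_grid n (1 / real K) = (\<Pi>\<^sub>E i\<in>{..<n}. (\<lambda>j. -1 + real j / real K) ` {..<2 * K})"
proof -
  \<comment> \<open>The last grid value 1 - 1/K corresponds to j + 1 = 2K, so each coordinate takes
    exactly 2K values.\<close>
  have "(-1 + real j * (1 / real K) \<le> 1 - 1 / real K) \<longleftrightarrow> j < 2 * K" for j
  proof -
    have "(-1 + real j * (1 / real K) \<le> 1 - 1 / real K) \<longleftrightarrow> real (Suc j) \<le> real (2 * K)"
    proof -
      have "(-1 + real j * (1 / real K) \<le> 1 - 1 / real K) \<longleftrightarrow> real (Suc j) / real K \<le> 2"
        by (auto simp: add_divide_distrib)
      also have "\<dots> \<longleftrightarrow> real (Suc j) \<le> real (2 * K)"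
        using assms by (simp add: divide_le_eq)
      finally show ?thesis .
    qed
    then show ?thesis by (simp only: of_nat_le_iff Suc_le_eq)
  qed
  then have "{-1 + real j * (1 / real K) | j :: nat. -1 + real j * (1 / real K) \<le> 1 - 1 / real K}
     = (\<lambda>j. -1 + real j / real K) ` {..<2 * K}" by auto
  then show ?thesis by (simp only: real_grid_def)
qed

lemma complex_grid_eq:
  assumes "0 < K"
  shows "complex_grid n (1 / real K) = grid_point K n ` (\<Pi>\<^sub>E i\<in>{..<2 * n}. {..<2 * K})"
proof (intro equalityI subsetI)
  fix z assume "z \<in> complex_grid n (1 / real K)"
  then obtain a b where z: "z = complex_point n a b"
    and a: "\<And>i. i < n \<Longrightarrow> a i \<in> (\<lambda>j. -1 + real j / real K) ` {..<2 * K}"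
    and b: "\<And>i. i < n \<Longrightarrow> b i \<in> (\<lambda>j. -1 + real j / real K) ` {..<2 * K}"
    unfolding complex_grid_def real_grid_eq[OF assms] by (auto simp: PiE_iff)
  obtain A where A: "\<And>i. i < n \<Longrightarrow> A i < 2 * K \<and> a i = -1 + real (A i) / real K"
    using a unfolding image_iff lessThan_iff Bex_def by metis
  obtain B where B: "\<And>i. i < n \<Longrightarrow> B i < 2 * K \<and> b i = -1 + real (B i) / real K"
    using b unfolding image_iff lessThan_iff Bex_def by metis
  let ?J = "\<lambda>i\<in>{..<2 * n}. if i < n then A i else B (i - n)"
  have "z = grid_point K n ?J"
    using A B by (auto simp: z grid_point_def complex_point_def fun_eq_iff)
  moreover have "?J \<in> (\<Pi>\<^sub>E i\<in>{..<2 * n}. {..<2 * K})" using A B by auto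
  ultimately show "z \<in> grid_point K n ` (\<Pi>\<^sub>E i\<in>{..<2 * n}. {..<2 * K})" by blast
next
  fix z assume "z \<in> grid_point K n ` (\<Pi>\<^sub>E i\<in>{..<2 * n}. {..<2 * K})"
  then obtain J where J: "J \<in> (\<Pi>\<^sub>E i\<in>{..<2 * n}. {..<2 * K})" and z: "z = grid_point K n J" by blast
  let ?a = "\<lambda>i\<in>{..<n}. -1 + real (J i) / real K" and ?b = "\<lambda>i\<in>{..<n}. -1 + real (J (n + i)) / real K"
  have "z = complex_point n ?a ?b"
    by (auto simp: z grid_point_def complex_point_def fun_eq_iff)
  moreover have "J i < 2 * K" if "i < 2 * n" for i using J that by auto
  then have "?a \<in> real_grid n (1 / real K)" "?b \<in> real_grid n (1 / real K)"
    unfolding real_grid_eq[OF assms] by auto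
  ultimately show "z \<in> complex_grid n (1 / real K)" unfolding complex_grid_def by blast
qed

text \<open>As the parametrisation is injective, the uniform distribution on the grid amounts to
  counting index tuples, which are also the indices of the cells.\<close>

lemma complex_grid_prob:
  assumes "0 < K"
  shows "\<P>(v in measure_pmf (pmf_of_set (complex_grid n (1 / real K))). P v)
    = real (card {J \<in> (\<Pi>\<^sub>E i\<in>{..<2 * n}. {..<2 * K}). P (grid_point K n J)}) / real (2 * K) ^ (2 * n)"
proof -
  let ?I = "\<Pi>\<^sub>E i\<in>{..<2 * n}. {..<2 * K}"
  have I: "finite ?I" "card ?I = (2 * K) ^ (2 * n)" by (auto intro: finite_PiE simp: card_PiE)
  have "?I \<noteq> {}" using assms by (auto simp: PiE_eq_empty_iff lessThan_empty_iff)
  then have "\<P>(v in measure_pmf (pmf_of_set (complex_grid n (1 / real K))). P v)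
     = real (card (grid_point K n ` ?I \<inter> {v. P v})) / real (card (grid_point K n ` ?I))"
    using I by (simp add: complex_grid_eq[OF assms] measure_pmf_of_set)
  also have "grid_point K n ` ?I \<inter> {v. P v} = grid_point K n ` {J \<in> ?I. P (grid_point K n J)}" by auto
  also have "card \<dots> = card {J \<in> ?I. P (grid_point K n J)}"
    by (intro card_image inj_on_subset[OF inj_on_grid_point[OF assms]]) auto
  also have "card (grid_point K n ` ?I) = (2 * K) ^ (2 * n)"
    using I by (simp add: card_image inj_on_grid_point[OF assms])
  finally show ?thesis by simp
qed

section \<open>Choice of the dominant part, rescaling, and the conclusion\<close>

lemma dominant_part:
  assumes "polynomial_in n f" "total_degree f \<le> r" "complex_l2_norm n f = 1"
  obtains g where "g \<in> poly_functions (2 * n) r" "1 / 2 \<le> l2_norm (2 * n) g" "l2_norm (2 * n) g \<le> 1"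
    "\<And>x. \<bar>g x\<bar> \<le> cmod (poly_eval f (complex_point n x (\<lambda>i. x (n + i))))"
proof -
  have "Re_poly n f \<in> poly_functions (2 * n) r" "Im_poly n f \<in> poly_functions (2 * n) r"
    using poly_eval_complex_point_in[OF assms(1,2)]
    unfolding complex_poly_functions_def Re_poly_def[abs_def] Im_poly_def[abs_def] by auto
  moreover have "0 \<le> l2_norm m h" for m h by (simp add: l2_norm_def)
  then have "0 \<le> l2_norm (2 * n) (Re_poly n f)" "0 \<le> l2_norm (2 * n) (Im_poly n f)" by auto
  ultimately show ?thesis
    using that[of "Re_poly n f"] that[of "Im_poly n f"] assms(3)
    unfolding complex_l2_norm_def
    by (cases "1 / 2 \<le> l2_norm (2 * n) (Re_poly n f)")
      (auto simp: Re_poly_def Im_poly_def abs_Re_le_cmod abs_Im_le_cmod)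
qed

text \<open>The Carbery-Wright property speaks of norm exactly 1, hence the division by the norm. As
  the norm is at least 1/2, the threshold \<alpha> for \<open>g\<close> turns into at most 2
  \<alpha> for the quotient.\<close>

lemma carbery_wright_scaled:
  assumes "carbery_wright C" "0 < m" "0 < r" "g \<in> poly_functions m r" "1 / 2 \<le> l2_norm m g" "0 < \<alpha>"
  shows "\<P>(v in uniform_on_cube m {-1..<1}. \<bar>g v\<bar> / l2_norm m g \<le> 2 * \<alpha>)
    \<le> C * real r * (2 * \<alpha>) powr (1 / real r)"
proof -
  let ?s = "l2_norm m g"
  have s: "0 < ?s" using assms(5) by simp
  have "(\<lambda>x. 1 / ?s * g x) \<in> poly_functions m (0 + r)"
    by (intro poly_functions_mult poly_functions_const assms(4))
  then obtain p where p: "polynomial_in m p" "total_degree p \<le> r"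
    and eq: "\<And>x. poly_eval p x = g x / ?s"
    unfolding poly_functions_def by (auto simp: fun_eq_iff)
  have norm: "l2_norm m (poly_eval p) = 1"
    using s unfolding l2_norm_def[of m "poly_eval p"] eq power_divide integral_divide_zero real_sqrt_divide
    by (simp add: l2_norm_def[symmetric])
  have "\<P>(v in uniform_on_cube m {-1..<1}. \<bar>poly_eval p v\<bar> \<le> 2 * \<alpha>)
      \<le> C * real r * (2 * \<alpha>) powr (1 / real r)"
    using assms(6)
    by (intro assms(1)[unfolded carbery_wright_def, rule_format] assms(2,3) p norm) simp
  then show ?thesis using s by (simp add: eq abs_of_pos)
qed

theorem mainTheorem4:
  fixes C\<^sub>C\<^sub>W \<delta> \<alpha> :: real and n r :: nat and f :: "complex mpolynomial"
  assumes "carbery_wright C\<^sub>C\<^sub>W"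
    and "0 < \<delta>" and "1 / \<delta> \<in> \<int>"
    and "0 < n" and "0 < r"
    and "polynomial_in n f" and "homogeneous f" and "total_degree f \<le> r"
    and "complex_l2_norm n f = 1"
    and "0 < \<alpha>"
  shows "\<P>(v in measure_pmf (pmf_of_set (complex_grid n \<delta>)).
            cmod (poly_eval f v) \<le> \<alpha> - 1 / 2 * \<delta> * (16 * real n * (real r)\<^sup>2) ^ (2 * n + 1))
         \<le> C\<^sub>C\<^sub>W * real r * (2 * \<alpha>) powr (1 / real r)"
proof -
  define E where "E = 1 / 2 * \<delta> * (16 * real n * (real r)\<^sup>2) ^ (2 * n + 1)"
  have "1 / \<delta> \<in> \<nat>" using assms(2,3) by (simp add: Nats_altdef2)
  then obtain K where "1 / \<delta> = real K" by (auto elim: Nats_cases)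
  then have \<delta>: "\<delta> = 1 / real K" by (metis inverse_eq_divide inverse_inverse_eq)
  then have K: "0 < K" using assms(2) by (cases K) auto
  obtain g where g: "g \<in> poly_functions (2 * n) r" "1 / 2 \<le> l2_norm (2 * n) g" "l2_norm (2 * n) g \<le> 1"
    and part: "\<And>x. \<bar>g x\<bar> \<le> cmod (poly_eval f (complex_point n x (\<lambda>i. x (n + i))))"
    using dominant_part assms(6,8,9) by blast
  let ?s = "l2_norm (2 * n) g"
  let ?B = "{J \<in> (\<Pi>\<^sub>E i\<in>{..<2 * n}. {..<2 * K}). cmod (poly_eval f (grid_point K n J)) \<le> \<alpha> - E}"
  let ?Q = "{v \<in> space (uniform_on_cube (2 * n) {-1..<1}). \<bar>g v\<bar> / ?s \<le> 2 * \<alpha>}"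
  have space: "space (uniform_on_cube (2 * n) {-1..<1}) = space (\<Pi>\<^sub>M i\<in>{..<2 * n}. (lborel :: real measure))"
    by (simp add: uniform_on_cube_def)
  have [measurable]: "g \<in> borel_measurable (\<Pi>\<^sub>M i\<in>{..<2 * n}. lborel)"
    using g(1) by (rule poly_functions_measurable) simp
  have Q: "?Q \<in> sets (\<Pi>\<^sub>M i\<in>{..<2 * n}. lborel)"
    unfolding space by measurable
  \<comment> \<open>The heart of the argument: if f is small at a grid point, then g is at most
    \<alpha> - E there, and at most \<alpha> on the whole cell because it varies by no more than
    E.\<close>
  have sub: "grid_cell K (2 * n) J \<subseteq> ?Q" if J: "J \<in> ?B" for J
  proof
    fix v assume v: "v \<in> grid_cell K (2 * n) J"
    \<comment> \<open>The lower corner of the cell, which is the grid point itself written as a real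
      vector.\<close>
    define w where "w = (\<lambda>i\<in>{..<2 * n}. -1 + real (J i) / real K)"
    have w: "w \<in> grid_cell K (2 * n) J"
      using K unfolding w_def grid_cell_def by auto
    have "grid_cell K (2 * n) J \<subseteq> (\<Pi>\<^sub>E i\<in>{..<2 * n}. {-1..<1})"
      using J by (intro grid_cell_subset_cube K) simp
    \<comment> \<open>The cells tile the half-open cube of the Carbery-Wright property, while the
      variation bound is stated on the closed cube of the norm.\<close>
    also have "\<dots> \<subseteq> (\<Pi>\<^sub>E i\<in>{..<2 * n}. {-1..1})" by (intro PiE_mono) auto
    finally have cube: "grid_cell K (2 * n) J \<subseteq> (\<Pi>\<^sub>E i\<in>{..<2 * n}. {-1..1})" .
    have "\<bar>v i - w i\<bar> \<le> \<delta>" if "i < 2 * n" for i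
      using v that unfolding grid_cell_def w_def \<delta> by (force simp: PiE_iff abs_le_iff)
    then have "\<bar>g v - g w\<bar> \<le> real (2 * n) * (sqrt (sup_L2_const r ^ (2 * n)) * (real r)\<^sup>2 * \<delta>)"
      using g v w cube assms(2)
      by (intro separately_poly_close poly_functions_separately_poly[OF g(1)] poly_functions_measurable[OF g(1)]) auto
    also have "\<dots> \<le> E"
      unfolding E_def using assms by (intro sup_L2_const_le) auto
    finally have "\<bar>g v - g w\<bar> \<le> E" .
    moreover have "complex_point n w (\<lambda>i. w (n + i)) = grid_point K n J"
      by (auto simp: w_def grid_point_def complex_point_def fun_eq_iff)
    then have "\<bar>g w\<bar> \<le> \<alpha> - E" using part[of w] J by simp
    ultimately have "\<bar>g v\<bar> \<le> \<alpha>" by linarith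
    also have "\<dots> \<le> 2 * \<alpha> * ?s" using g(2) assms(10) by (simp add: mult_le_cancel_left1)
    finally have "\<bar>g v\<bar> / ?s \<le> 2 * \<alpha>" using g(2) by (simp add: divide_le_eq)
    moreover have "v \<in> space (\<Pi>\<^sub>M i\<in>{..<2 * n}. (lborel :: real measure))"
      using v unfolding grid_cell_def by (auto simp: space_PiM PiE_iff)
    ultimately show "v \<in> ?Q" unfolding space by simp
  qed
  have "\<P>(v in measure_pmf (pmf_of_set (complex_grid n \<delta>)). cmod (poly_eval f v) \<le> \<alpha> - E)
      = real (card ?B) / real (2 * K) ^ (2 * n)"
    unfolding \<delta> by (rule complex_grid_prob[OF K])
  also have "\<dots> \<le> measure (uniform_on_cube (2 * n) {-1..<1}) ?Q"
    by (rule grid_fraction_le_cube_prob[OF K Q _ sub]) auto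
  also have "\<dots> \<le> C\<^sub>C\<^sub>W * real r * (2 * \<alpha>) powr (1 / real r)"
    using assms g by (intro carbery_wright_scaled) auto
  finally show ?thesis unfolding E_def .
qed

end
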